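(* For every $n\in\mathbb N$, let $\Gamma_n\curvearrowright (X_n,\mu_n)$ be a strongly ergodic free p.m.p. action of an infinite countable group $\Gamma_n$. Define $\Gamma=\bigoplus_{n\in\mathbb N}\Gamma_n$, $(X,\mu)=\prod_{n\in\mathbb N}(X_n,\mu_n)$, and consider the product action $\Gamma\curvearrowright (X,\mu)$ given by $g\cdot x=(g_n\cdot x_n)_n$, for all $g=(g_n)_n\in\Gamma$ and $x=(x_n)_n\in X$. Then the orbit equivalence relation $\mathcal R(\Gamma\curvearrowright X)=\{(x,y)\in X^2:\Gamma\cdot x=\Gamma\cdot y\}$ does not have the Jones–Schmidt property.
   Context: Probability spaces are standard; p.m.p. means probability measure preserving. For a countable p.m.p. equivalence relation $\mathcal R$ on $(X,\mu)$, $[x]_{\mathcal R}$ is the class of $x$ and the full group $[\mathcal R]$ is the group of automorphisms $\alpha$ of $(X,\mu)$ with $(\alpha(x),x)\in\mathcal R$ for a.e. $x$. $\mathcal R$ is strongly ergodic if every sequence of measurable sets $A_n\subset X$ with $\mu(\alpha(A_n)\triangle A_n)\to0$ for all $\alpha\in[\mathcal R]$ satisfies $\mu(A_n)(1-\mu(A_n))\to0$; a p.m.p. action of a countable group is strongly ergodic iff its orbit equivalence relation is. Jones–Schmidt property: a countable ergodic p.m.p. equivalence relation $\mathcal S$ on $(X,\mu)$ has the Jones–Schmidt property if there exist a hyperfinite ergodic p.m.p. equivalence relation $\mathcal T$ on a probability space $(Y,\nu)$ and a factor map (measurable, measure preserving) $\pi:(X,\mu)\to(Y,\nu)$ such that (1)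 $\pi([x]_{\mathcal S})=[\pi(x)]_{\mathcal T}$ for almost every $x\in X$, and (2) $\mathcal S_0=\{(x_1,x_2)\in\mathcal S:\pi(x_1)=\pi(x_2)\}$ is strongly ergodic on almost every ergodic component of $\mathcal S_0$. *)

theory Defs
  imports "HOL-Probability.Probability" "HOL-Algebra.Product_Groups" "HOL-Algebra.Group_Action"
begin

text \<open>
  A standard probability space is a Borel probability measure on a standard Borel space.
  The measure is not completed, atoms are allowed, and the Polish topology is only required
  to exist.
\<close>

definition standard_borel :: "'a measure \<Rightarrow> bool" where
  "standard_borel M \<longleftrightarrow>
     (\<exists>X. completely_metrizable_space X \<and> second_countable X \<and> topspace X = space M \<and>
          sets M = sigma_sets (space M) {U. openin X U})"

definition standard_prob_space :: "'a measure \<Rightarrow> bool" where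
  "standard_prob_space M \<longleftrightarrow> prob_space M \<and> standard_borel M"

definition measure_preserving_map :: "'a measure \<Rightarrow> 'b measure \<Rightarrow> ('a \<Rightarrow> 'b) \<Rightarrow> bool" where
  "measure_preserving_map M N f \<longleftrightarrow> f \<in> M \<rightarrow>\<^sub>M N \<and> distr M N f = N"


text \<open>
  The last conjunct is invariance of the measure under the relation: partial Borel isomorphisms
  with graph in \<open>R\<close> preserve the measure.
\<close>

definition countable_pmp_rel :: "'a measure \<Rightarrow> ('a \<times> 'a) set \<Rightarrow> bool" where
  "countable_pmp_rel M R \<longleftrightarrow>
     equiv (space M) R \<and>
     R \<in> sets (M \<Otimes>\<^sub>M M) \<and>
     (\<forall>x\<in>space M. countable (R `` {x})) \<and>
     (\<forall>A\<in>sets M. \<forall>B\<in>sets M. \<forall>\<phi>.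
        bij_betw \<phi> A B \<and>
        \<phi> \<in> restrict_space M A \<rightarrow>\<^sub>M restrict_space M B \<and>
        the_inv_into A \<phi> \<in> restrict_space M B \<rightarrow>\<^sub>M restrict_space M A \<and>
        (\<forall>x\<in>A. (x, \<phi> x) \<in> R)
        \<longrightarrow> emeasure M A = emeasure M B)"

definition ergodic_rel :: "'a measure \<Rightarrow> ('a \<times> 'a) set \<Rightarrow> bool" where
  "ergodic_rel M R \<longleftrightarrow>
     (\<forall>A\<in>sets M. R `` A \<subseteq> A \<longrightarrow> measure M A = 0 \<or> measure M A = 1)"

text \<open>
  For a countable p.m.p. relation, every automorphism modulo null sets that is almost everywhere
  contained in \<open>R\<close> agrees almost everywhere with one that is a bimeasurable bijection of the
  whole space: restrict it to an \<open>R\<close>-invariant conull set on which it is bijective and extend it by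
  the identity. So it suffices to consider such bijections; for them images of measurable sets are
  measurable.
\<close>

definition full_group :: "'a measure \<Rightarrow> ('a \<times> 'a) set \<Rightarrow> ('a \<Rightarrow> 'a) set" where
  "full_group M R =
     {\<alpha>. bij_betw \<alpha> (space M) (space M) \<and>
         measure_preserving_map M M \<alpha> \<and>
         the_inv_into (space M) \<alpha> \<in> M \<rightarrow>\<^sub>M M \<and>
         (AE x in M. (\<alpha> x, x) \<in> R)}"

definition strongly_ergodic_rel :: "'a measure \<Rightarrow> ('a \<times> 'a) set \<Rightarrow> bool" where
  "strongly_ergodic_rel M R \<longleftrightarrow>
     (\<forall>A :: nat \<Rightarrow> 'a set.
        (\<forall>n. A n \<in> sets M) \<and>
        (\<forall>\<alpha>\<in>full_group M R. (\<lambda>n. measure M (sym_diff (\<alpha> ` A n) (A n))) \<longlonglongrightarrow> 0)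
        \<longrightarrow> (\<lambda>n. measure M (A n) * (1 - measure M (A n))) \<longlonglongrightarrow> 0)"

definition hyperfinite_rel :: "'a measure \<Rightarrow> ('a \<times> 'a) set \<Rightarrow> bool" where
  "hyperfinite_rel M R \<longleftrightarrow>
     (\<exists>F :: nat \<Rightarrow> ('a \<times> 'a) set.
        (\<forall>n. equiv (space M) (F n) \<and> F n \<in> sets (M \<Otimes>\<^sub>M M) \<and>
             (\<forall>x\<in>space M. finite (F n `` {x})) \<and> F n \<subseteq> F (Suc n)) \<and>
        (AE x in M. R `` {x} = (\<Union>n. F n `` {x})))"

text \<open>
  Ergodic decomposition in the form of Farrell and Varadarajan: \<open>e\<close> sends a point to the invariant
  ergodic measure of the ergodic component containing it. The component of \<open>x\<close> is the set
  \<open>{y. e y = e x}\<close> with the probability measure \<open>e x\<close>, which is concentrated on it. Such an \<open>e\<close>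
  exists for every countable p.m.p. relation on a standard probability space, and it is unique
  up to null sets.
\<close>

definition ergodic_decomposition ::
    "'a measure \<Rightarrow> ('a \<times> 'a) set \<Rightarrow> ('a \<Rightarrow> 'a measure) \<Rightarrow> bool" where
  "ergodic_decomposition M R e \<longleftrightarrow>
     e \<in> M \<rightarrow>\<^sub>M prob_algebra M \<and>
     bind M e = M \<and>
     (AE x in M. \<forall>y\<in>R `` {x}. e y = e x) \<and>
     (AE x in M. AE y in e x. e y = e x) \<and>
     (AE x in M. countable_pmp_rel (e x) R \<and> ergodic_rel (e x) R)"

definition kernel_subrel :: "('a \<times> 'a) set \<Rightarrow> ('a \<Rightarrow> 'b) \<Rightarrow> ('a \<times> 'a) set" where
  "kernel_subrel S \<pi> = {(x, y) \<in> S. \<pi> x = \<pi> y}"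

text \<open>
  HOL cannot quantify over the type of the points of the factor space inside a definition, so this
  type is a parameter. The property is intended for countable ergodic p.m.p. relations \<open>S\<close>; this
  is not part of the definition, so that its negation does not hold merely because
  \<open>S\<close> is not of this kind.
\<close>

definition jones_schmidt :: "'y itself \<Rightarrow> 'a measure \<Rightarrow> ('a \<times> 'a) set \<Rightarrow> bool" where
  "jones_schmidt Y M S \<longleftrightarrow>
     (\<exists>(N :: 'y measure) T \<pi>.
        standard_prob_space N \<and>
        countable_pmp_rel N T \<and> ergodic_rel N T \<and> hyperfinite_rel N T \<and>
        measure_preserving_map M N \<pi> \<and>
        (AE x in M. \<pi> ` (S `` {x}) = T `` {\<pi> x}) \<and>
        (\<exists>e. ergodic_decomposition M (kernel_subrel S \<pi>) e \<and>
             (AE x in M. strongly_ergodic_rel (e x) (kernel_subrel S \<pi>))))"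


definition pmp_action :: "('g, 'b) monoid_scheme \<Rightarrow> 'a measure \<Rightarrow> ('g \<Rightarrow> 'a \<Rightarrow> 'a) \<Rightarrow> bool" where
  "pmp_action G M \<phi> \<longleftrightarrow>
     group_action G (space M) \<phi> \<and> (\<forall>g\<in>carrier G. measure_preserving_map M M (\<phi> g))"

text \<open>Freeness of a p.m.p. action is understood almost everywhere.\<close>

definition free_action :: "('g, 'b) monoid_scheme \<Rightarrow> 'a measure \<Rightarrow> ('g \<Rightarrow> 'a \<Rightarrow> 'a) \<Rightarrow> bool" where
  "free_action G M \<phi> \<longleftrightarrow> (\<forall>g\<in>carrier G - {\<one>\<^bsub>G\<^esub>}. AE x in M. \<phi> g x \<noteq> x)"

definition orbit_rel ::
    "('g, 'b) monoid_scheme \<Rightarrow> 'a measure \<Rightarrow> ('g \<Rightarrow> 'a \<Rightarrow> 'a) \<Rightarrow> ('a \<times> 'a) set" where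
  "orbit_rel G M \<phi> = {(x, y) \<in> space M \<times> space M. orbit G \<phi> x = orbit G \<phi> y}"

definition strongly_ergodic_action ::
    "('g, 'b) monoid_scheme \<Rightarrow> 'a measure \<Rightarrow> ('g \<Rightarrow> 'a \<Rightarrow> 'a) \<Rightarrow> bool" where
  "strongly_ergodic_action G M \<phi> \<longleftrightarrow> strongly_ergodic_rel M (orbit_rel G M \<phi>)"

text \<open>The restriction to the space is needed because \<^const>\<open>group_action\<close> uses extensional maps.\<close>

definition product_action ::
    "('i \<Rightarrow> 'a measure) \<Rightarrow> ('i \<Rightarrow> 'g \<Rightarrow> 'a \<Rightarrow> 'a) \<Rightarrow> ('i \<Rightarrow> 'g) \<Rightarrow> ('i \<Rightarrow> 'a) \<Rightarrow> 'i \<Rightarrow> 'a" where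
  "product_action M \<phi> g =
     restrict (\<lambda>x n. \<phi> n (g n) (x n)) (space (PiM UNIV M))"

end

theory Submission
  imports Defs
begin

text \<open>
  Suppose that \<open>\<pi>\<close> and the ergodic decomposition \<open>e\<close> of the kernel relation witness the property.
  Sets that depend on the \<open>k\<close>-th coordinate only are asymptotically invariant as \<open>k\<close> tends to
  infinity, because an element of the direct sum acts on finitely many coordinates. Strong
  ergodicity of the components makes all such sets nearly trivial for \<open>e x\<close>, so for some \<open>k\<close> it
  happens with positive probability that \<open>e y\<close> gives positive mass to the fibre through \<open>y\<close> of the
  \<open>k\<close>-th coordinate.

  Now fix generic values of the other coordinates. On \<open>X\<^sub>k\<close> the map \<open>\<pi>\<close> sends orbits of \<open>\<Gamma>\<^sub>k\<close> into
  classes of a hyperfinite relation, and strong ergodicity of \<open>\<Gamma>\<^sub>k\<close> forces \<open>\<pi>\<close> to be constant on a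
  set of positive measure on which those masses are positive. The points of one orbit in this set
  are equivalent under the kernel relation, hence have the same \<open>e\<close>, and their masses add up to at
  most 1. Integrated over \<open>X\<^sub>k\<close>, this contradicts the infinitude of \<open>\<Gamma>\<^sub>k\<close>.
\<close>

section \<open>Standard Borel spaces: countable separation, singletons, the diagonal\<close>

text \<open>A countable base works, because the complement of a finite set is open in a T1 space.
  Finite \<open>P\<close> rather than single points are needed later, where \<open>P\<close> is a
  finite class of a hyperfinite relation.\<close>

lemma standard_borel_separating:
  assumes "standard_borel N"
  obtains B :: "nat \<Rightarrow> 'a set" where "\<And>i. B i \<in> sets N"
    and "\<And>P q. finite P \<Longrightarrow> q \<in> space N \<Longrightarrow> q \<notin> P \<Longrightarrow> \<exists>i. q \<in> B i \<and> B i \<inter> P = {}"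
proof -
  obtain X where X: "completely_metrizable_space X" "second_countable X" "topspace X = space N"
    "sets N = sigma_sets (space N) {U. openin X U}"
    using assms unfolding standard_borel_def by blast
  obtain \<B> where \<B>: "countable \<B>" "\<And>V. V \<in> \<B> \<Longrightarrow> openin X V"
    and base: "\<forall>U x. openin X U \<and> x \<in> U \<longrightarrow> (\<exists>V\<in>\<B>. x \<in> V \<and> V \<subseteq> U)"
    using X(2) unfolding second_countable_def by (elim exE conjE) simp
  have t1: "t1_space X"
    using X(1) by (simp add: Hausdorff_imp_t1_space completely_metrizable_imp_metrizable_space
        metrizable_imp_Hausdorff_space)
  \<comment> \<open>Inserting \<open>{}\<close> makes the family nonempty, so that it can be
    enumerated by \<open>nat\<close> even if the base is empty.\<close>
  define B where "B = from_nat_into (insert {} \<B>)"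
  have rB: "range B = insert {} \<B>"
    unfolding B_def using \<B>(1) by (intro range_from_nat_into) auto
  show thesis
  proof
    show "B i \<in> sets N" for i
    proof -
      have "B i \<in> insert {} \<B>" using rB by blast
      then have "openin X (B i)" using \<B>(2) by auto
      then show ?thesis unfolding X(4) by (intro sigma_sets.Basic) simp
    qed
    show "\<exists>i. q \<in> B i \<and> B i \<inter> P = {}" if "finite P" "q \<in> space N" "q \<notin> P" for P q
    proof -
      have "closedin X (topspace X \<inter> P)"
        using t1 that(1) by (simp add: t1_space_closedin_finite)
      then have "openin X (topspace X - (topspace X \<inter> P))"
        by blast
      moreover have "q \<in> topspace X - (topspace X \<inter> P)" using that X(3) by auto
      ultimately obtain V where V: "V \<in> \<B>" "q \<in> V" "V \<subseteq> topspace X - (topspace X \<inter> P)"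
        using base by meson
      then have "V \<in> range B" using rB by simp
      then show ?thesis using V by fastforce
    qed
  qed
qed

lemma standard_borel_singleton:
  assumes "standard_borel N" "p \<in> space N"
  shows "{p} \<in> sets N"
proof -
  obtain B :: "nat \<Rightarrow> 'a set" where B: "\<And>i. B i \<in> sets N"
    "\<And>P q. finite P \<Longrightarrow> q \<in> space N \<Longrightarrow> q \<notin> P \<Longrightarrow> \<exists>i. q \<in> B i \<and> B i \<inter> P = {}"
    using standard_borel_separating[OF assms(1)] by blast
  have "{p} = space N - (\<Union>i\<in>{i. p \<notin> B i}. B i)"
  proof (intro equalityI subsetI)
    fix q assume "q \<in> space N - (\<Union>i\<in>{i. p \<notin> B i}. B i)"
    then show "q \<in> {p}" using B(2)[of "{p}" q] by auto
  qed (use assms in auto)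
  also have "\<dots> \<in> sets N" using B(1) by auto
  finally show ?thesis .
qed

lemma standard_borel_diagonal:
  assumes "standard_borel N"
  shows "{z \<in> space (N \<Otimes>\<^sub>M N). fst z = snd z} \<in> sets (N \<Otimes>\<^sub>M N)"
proof -
  obtain B :: "nat \<Rightarrow> 'a set" where B: "\<And>i. B i \<in> sets N"
    "\<And>P q. finite P \<Longrightarrow> q \<in> space N \<Longrightarrow> q \<notin> P \<Longrightarrow> \<exists>i. q \<in> B i \<and> B i \<inter> P = {}"
    using standard_borel_separating[OF assms(1)] by blast
  have "{z \<in> space (N \<Otimes>\<^sub>M N). fst z = snd z} =
      space (N \<Otimes>\<^sub>M N) - (\<Union>i. B i \<times> (space N - B i))"
  proof (intro equalityI subsetI)
    fix z assume "z \<in> space (N \<Otimes>\<^sub>M N) - (\<Union>i. B i \<times> (space N - B i))"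
    then show "z \<in> {z \<in> space (N \<Otimes>\<^sub>M N). fst z = snd z}"
      using B(2)[of "{snd z}" "fst z"] by (cases z) (auto simp: space_pair_measure)
  qed auto
  also have "\<dots> \<in> sets (N \<Otimes>\<^sub>M N)" using B(1) by auto
  finally show ?thesis .
qed

section \<open>Strong ergodicity and asymptotically invariant sigma-algebras\<close>

text \<open>
  The trivial sets of small measure are closed under unions, so the union of the small ones among
  each \<open>C i\<close> and its complement is small; outside of it nothing is separated.
\<close>

lemma (in prob_space) trivial_sigma_algebra_not_separating:
  fixes C :: "nat \<Rightarrow> 'a set"
  assumes \<A>: "sigma_algebra (space M) \<A>" "\<A> \<subseteq> sets M"
    and \<epsilon>: "0 < \<epsilon>" "\<epsilon> \<le> 1 / 3"
    and triv: "\<And>A. A \<in> \<A> \<Longrightarrow> prob A < \<epsilon> \<or> prob A > 1 - \<epsilon>"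
    and C: "\<And>i. C i \<in> \<A>"
  obtains Z where "Z \<in> sets M" "prob Z > 1 - \<epsilon>"
    and "\<And>u v i. u \<in> Z \<Longrightarrow> v \<in> Z \<Longrightarrow> u \<in> C i \<longleftrightarrow> v \<in> C i"
proof -
  interpret \<A>: sigma_algebra "space M" \<A> by fact
  define D where "D i = (if prob (C i) < \<epsilon> then C i else space M - C i)" for i
  have D: "D i \<in> \<A>" for i using C by (auto simp: D_def)
  have Dp: "prob (D i) < \<epsilon>" for i
    using triv[OF C[of i]] prob_compl[of "C i"] C[of i] \<A>(2) by (auto simp: D_def)
  define U where "U n = (\<Union>i<n. D i)" for n
  have U: "U n \<in> \<A>" for n unfolding U_def using D by auto
  have Up: "prob (U n) < \<epsilon>" for n
  proof (induction n)
    case 0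
    then show ?case using \<epsilon> by (simp add: U_def)
  next
    case (Suc n)
    have "U (Suc n) = U n \<union> D n" by (auto simp: U_def lessThan_Suc)
    then have "prob (U (Suc n)) \<le> prob (U n) + prob (D n)"
      using U D \<A>(2) by (simp add: measure_Un_le subset_iff)
    \<comment> \<open>The union has measure below \<open>2 * \<epsilon>\<close>, which is at most
      \<open>1 - \<epsilon>\<close> as \<epsilon> \<le> 1/3; so the dichotomy \<open>triv\<close>
      puts it back among the small sets.\<close>
    then have "\<not> prob (U (Suc n)) > 1 - \<epsilon>" using Suc Dp[of n] \<epsilon> by linarith
    then show ?case using triv[OF U] by blast
  qed
  have "(\<lambda>n. prob (U n)) \<longlonglongrightarrow> prob (\<Union>n. U n)"
    using U \<A>(2) by (intro finite_Lim_measure_incseq)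
      (auto simp: U_def lessThan_Suc intro!: incseq_SucI)
  then have "prob (\<Union>n. U n) \<le> \<epsilon>"
    by (rule LIMSEQ_le_const2) (use Up in \<open>auto intro: less_imp_le\<close>)
  moreover have UU: "(\<Union>n. U n) \<in> \<A>" using U by auto
  \<comment> \<open>The limit gives only a weak inequality; the dichotomy makes it strict
    again.\<close>
  ultimately have "prob (\<Union>n. U n) < \<epsilon>" using triv[OF UU] \<epsilon> by auto
  then have pr: "prob (space M - (\<Union>n. U n)) > 1 - \<epsilon>"
    using prob_compl[of "\<Union>n. U n"] UU \<A>(2) by auto
  show thesis
  proof
    show "space M - (\<Union>n. U n) \<in> sets M" using UU \<A>(2) by auto
    show "u \<in> C i \<longleftrightarrow> v \<in> C i"
      if "u \<in> space M - (\<Union>n. U n)" "v \<in> space M - (\<Union>n. U n)" for u v i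
    proof -
      have "D i \<subseteq> U (Suc i)" by (auto simp: U_def)
      then have "u \<notin> D i" "v \<notin> D i" using that by auto
      then show ?thesis using that by (auto simp: D_def split: if_splits)
    qed
  qed (fact pr)
qed

text \<open>Since \<alpha> preserves the measure, the symmetric difference is as large as the set
  \<open>S n\<close> of points \<open>y\<close> for which exactly one of \<open>y\<close> and
  \<open>\<alpha> y\<close> lies in \<open>A n\<close>. Almost every point lies in only finitely
  many \<open>S n\<close>, so dominated convergence applies.\<close>

lemma (in prob_space) full_group_sym_diff_tendsto_0:
  assumes \<alpha>: "\<alpha> \<in> full_group M R"
    and A: "\<And>n. A n \<in> sets M"
    and inv: "AE x in M. \<forall>y. (y, x) \<in> R \<longrightarrow> (\<forall>\<^sub>F n in sequentially. x \<in> A n \<longleftrightarrow> y \<in> A n)"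
  shows "(\<lambda>n. prob (sym_diff (\<alpha> ` A n) (A n))) \<longlonglongrightarrow> 0"
proof -
  have bij: "bij_betw \<alpha> (space M) (space M)" and m\<alpha>[measurable]: "\<alpha> \<in> M \<rightarrow>\<^sub>M M"
    and d: "distr M M \<alpha> = M" and mi: "the_inv_into (space M) \<alpha> \<in> M \<rightarrow>\<^sub>M M"
    and R: "AE x in M. (\<alpha> x, x) \<in> R"
    using \<alpha> by (auto simp: full_group_def measure_preserving_map_def)
  have inj: "inj_on \<alpha> (space M)" and im: "\<alpha> ` space M = space M"
    using bij by (auto simp: bij_betw_def)
  define S where "S n = {y \<in> space M. (y \<in> A n) \<noteq> (\<alpha> y \<in> A n)}" for n
  have S[measurable]: "S n \<in> sets M" for n unfolding S_def using A[of n] by measurable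
  have eq: "prob (sym_diff (\<alpha> ` A n) (A n)) = prob (S n)" for n
  proof -
    have As: "A n \<subseteq> space M" using A sets.sets_into_space by blast
    have "\<alpha> ` A n = the_inv_into (space M) \<alpha> -` A n \<inter> space M"
    proof (intro equalityI subsetI)
      fix y assume "y \<in> \<alpha> ` A n"
      then show "y \<in> the_inv_into (space M) \<alpha> -` A n \<inter> space M"
        using As inj im by (auto simp: the_inv_into_f_f subset_iff)
    next
      fix y assume y: "y \<in> the_inv_into (space M) \<alpha> -` A n \<inter> space M"
      then have "\<alpha> (the_inv_into (space M) \<alpha> y) = y"
        using inj im by (intro f_the_inv_into_f) auto
      then show "y \<in> \<alpha> ` A n" using y by (metis IntD1 imageI vimageD)
    qed
    then have [measurable]: "\<alpha> ` A n \<in> sets M" using mi A by auto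
    have "prob (sym_diff (\<alpha> ` A n) (A n)) = measure (distr M M \<alpha>) (sym_diff (\<alpha> ` A n) (A n))"
      by (simp add: d)
    also have "\<dots> = prob (\<alpha> -` (sym_diff (\<alpha> ` A n) (A n)) \<inter> space M)"
      using A by (intro measure_distr) auto
    also have "\<alpha> -` (sym_diff (\<alpha> ` A n) (A n)) \<inter> space M = S n"
    proof -
      have "\<alpha> y \<in> \<alpha> ` A n \<longleftrightarrow> y \<in> A n" if "y \<in> space M" for y
        using inj_on_image_mem_iff[OF inj that As] .
      then show ?thesis by (auto simp: S_def)
    qed
    finally show ?thesis .
  qed
  have "(\<lambda>n. LINT x|M. indicator (S n) x) \<longlonglongrightarrow> (LINT x|M. (0::real))"
  proof (rule integral_dominated_convergence)
    show "AE x in M. (\<lambda>n. indicator (S n) x :: real) \<longlonglongrightarrow> 0"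
      using R inv
    proof eventually_elim
      case (elim x)
      then have "\<forall>\<^sub>F n in sequentially. x \<in> A n \<longleftrightarrow> \<alpha> x \<in> A n" by blast
      then have "\<forall>\<^sub>F n in sequentially. indicator (S n) x = (0::real)"
        by eventually_elim (auto simp: S_def)
      then show ?case by (rule tendsto_eventually)
    qed
    show "AE x in M. norm (indicator (S n) x :: real) \<le> 1" for n
      by (auto split: split_indicator)
  qed (auto)
  then show ?thesis unfolding eq using S by simp
qed

text \<open>If each \<open>\<A> n\<close> contained a set of measure between \<delta> and
  \<open>1 - \<delta>\<close>, these sets would be asymptotically invariant but not asymptotically
  trivial. So some \<open>\<A> n\<close> is nearly trivial, and its sets \<open>C n i\<close> do not
  separate most points. This is applied to two filtrations: sets invariant under finite
  subrelations, and sets depending on one coordinate.\<close>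

lemma strongly_ergodic_not_separating:
  fixes C :: "nat \<Rightarrow> nat \<Rightarrow> 'a set"
  assumes M: "prob_space M" and R: "strongly_ergodic_rel M R"
    and \<A>: "\<And>n. sigma_algebra (space M) (\<A> n)" "\<And>n. \<A> n \<subseteq> sets M"
    and inv: "\<And>A. (\<And>n. A n \<in> \<A> n) \<Longrightarrow>
      AE x in M. \<forall>y. (y, x) \<in> R \<longrightarrow> (\<forall>\<^sub>F n in sequentially. x \<in> A n \<longleftrightarrow> y \<in> A n)"
    and C: "\<And>n i. C n i \<in> \<A> n" and \<epsilon>: "0 < \<epsilon>"
  obtains n Z where "Z \<in> sets M" "measure M Z > 1 - \<epsilon>"
    and "\<And>u v i. u \<in> Z \<Longrightarrow> v \<in> Z \<Longrightarrow> u \<in> C n i \<longleftrightarrow> v \<in> C n i"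
proof -
  interpret prob_space M by fact
  define \<delta> where "\<delta> = min \<epsilon> (1 / 3)"
  have \<delta>: "0 < \<delta>" "\<delta> \<le> 1 / 3" "\<delta> \<le> \<epsilon>" using \<epsilon> by (auto simp: \<delta>_def)
  have "\<exists>n. \<forall>A\<in>\<A> n. prob A < \<delta> \<or> prob A > 1 - \<delta>"
  proof (rule ccontr)
    assume "\<nexists>n. \<forall>A\<in>\<A> n. prob A < \<delta> \<or> prob A > 1 - \<delta>"
    then have "\<forall>n. \<exists>A. A \<in> \<A> n \<and> \<delta> \<le> prob A \<and> prob A \<le> 1 - \<delta>" by (meson not_less)
    then obtain A where A: "\<And>n. A n \<in> \<A> n" "\<And>n. \<delta> \<le> prob (A n)" "\<And>n. prob (A n) \<le> 1 - \<delta>"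
      by metis
    have As: "A n \<in> sets M" for n using A(1) \<A>(2) by blast
    have "\<forall>\<alpha>\<in>full_group M R. (\<lambda>n. prob (sym_diff (\<alpha> ` A n) (A n))) \<longlonglongrightarrow> 0"
      using full_group_sym_diff_tendsto_0[OF _ As inv[OF A(1)]] by simp
    then have "(\<lambda>n. prob (A n) * (1 - prob (A n))) \<longlonglongrightarrow> 0"
      using R[unfolded strongly_ergodic_rel_def, THEN spec, of A] As by simp
    moreover have "\<delta> * \<delta> \<le> prob (A n) * (1 - prob (A n))" for n
      using A(2,3)[of n] \<delta> by (intro mult_mono) auto
    ultimately have "\<delta> * \<delta> \<le> 0" by (intro LIMSEQ_le_const) auto
    then show False using \<delta> by (simp add: mult_le_0_iff)
  qed
  then obtain n where n: "\<And>A. A \<in> \<A> n \<Longrightarrow> prob A < \<delta> \<or> prob A > 1 - \<delta>" by blast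
  show thesis
  proof (rule trivial_sigma_algebra_not_separating[where C = "C n" and \<A> = "\<A> n",
        OF \<A> \<delta>(1,2) n C])
    fix Z assume Z: "Z \<in> sets M" "prob Z > 1 - \<delta>"
      and sep: "\<And>u v i. u \<in> Z \<Longrightarrow> v \<in> Z \<Longrightarrow> u \<in> C n i \<longleftrightarrow> v \<in> C n i"
    have "prob Z > 1 - \<epsilon>" using Z(2) \<delta>(3) by linarith
    from Z(1) this sep show thesis by (rule that)
  qed
qed

section \<open>Measure preserving actions and their orbit relations\<close>

lemma pmp_actionD:
  assumes "pmp_action G M \<phi>"
  shows "group_action G (space M) \<phi>"
    and "g \<in> carrier G \<Longrightarrow> \<phi> g \<in> M \<rightarrow>\<^sub>M M"
    and "g \<in> carrier G \<Longrightarrow> distr M M (\<phi> g) = M"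
  using assms by (auto simp: pmp_action_def measure_preserving_map_def)

lemma orbit_rel_iff:
  assumes "group_action G (space M) \<phi>"
  shows "(x, y) \<in> orbit_rel G M \<phi> \<longleftrightarrow> x \<in> space M \<and> (\<exists>g\<in>carrier G. y = \<phi> g x)"
proof -
  interpret group_action G "space M" \<phi> by fact
  show ?thesis
  proof
    assume "(x, y) \<in> orbit_rel G M \<phi>"
    then have "x \<in> space M" "y \<in> space M" "orbit G \<phi> x = orbit G \<phi> y"
      by (auto simp: orbit_rel_def)
    then have "y \<in> orbit G \<phi> x" using orbit_refl by simp
    then show "x \<in> space M \<and> (\<exists>g\<in>carrier G. y = \<phi> g x)"
      using \<open>x \<in> space M\<close> by (auto simp: orbit_def)
  next
    assume R: "x \<in> space M \<and> (\<exists>g\<in>carrier G. y = \<phi> g x)"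
    then have x: "x \<in> space M" and xy: "y \<in> orbit G \<phi> x" by (auto simp: orbit_def)
    have y: "y \<in> space M" using R element_image by blast
    have yx: "x \<in> orbit G \<phi> y" using orbit_sym[OF x y xy] .
    have sub: "orbit G \<phi> b \<subseteq> orbit G \<phi> a"
      if "a \<in> space M" "b \<in> space M" "b \<in> orbit G \<phi> a" for a b
    proof
      fix c assume c: "c \<in> orbit G \<phi> b"
      then have "c \<in> space M" using that element_image by (auto simp: orbit_def)
      then show "c \<in> orbit G \<phi> a" using orbit_trans that c by blast
    qed
    have "orbit G \<phi> x = orbit G \<phi> y" using sub[OF x y xy] sub[OF y x yx] by auto
    then show "(x, y) \<in> orbit_rel G M \<phi>" using x y by (simp add: orbit_rel_def)
  qed
qed

text \<open>All translates of \<open>q\<close> have the same integral, so by Tonelli the orbit sum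
  of \<open>q\<close> has integral \<open>integral\<^sup>N M q * \<infinity>\<close>. The bound
  makes this at most 1, which forces the integral of \<open>q\<close> to vanish.\<close>

lemma pmp_action_AE_eq_0:
  assumes act: "pmp_action G M \<phi>" and M: "prob_space M"
    and G: "countable (carrier G)" "infinite (carrier G)"
    and q[measurable]: "q \<in> borel_measurable M"
    and bound: "AE u in M. (\<integral>\<^sup>+g. q (\<phi> g u) \<partial>count_space (carrier G)) \<le> 1"
  shows "AE u in M. q u = 0"
proof -
  interpret prob_space M by fact
  have "(\<integral>\<^sup>+u. q (\<phi> g u) \<partial>M) = integral\<^sup>N M q" if g: "g \<in> carrier G" for g
  proof -
    have "integral\<^sup>N M q = integral\<^sup>N (distr M M (\<phi> g)) q"
      using pmp_actionD(3)[OF act g] by simp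
    also have "\<dots> = (\<integral>\<^sup>+u. q (\<phi> g u) \<partial>M)"
      using pmp_actionD(2)[OF act g] by (intro nn_integral_distr) auto
    finally show ?thesis by simp
  qed
  then have "(\<integral>\<^sup>+g. \<integral>\<^sup>+u. q (\<phi> g u) \<partial>M \<partial>count_space (carrier G)) =
      (\<integral>\<^sup>+g. integral\<^sup>N M q \<partial>count_space (carrier G))"
    by (rule nn_integral_cong) (simp only: space_count_space)
  also have "\<dots> = integral\<^sup>N M q * \<infinity>"
    using G(2) by simp
  finally have "(\<integral>\<^sup>+u. \<integral>\<^sup>+g. q (\<phi> g u) \<partial>count_space (carrier G) \<partial>M) = integral\<^sup>N M q * \<infinity>"
    using G(1) pmp_actionD(2)[OF act] by (subst nn_integral_count_space_nn_integral) auto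
  moreover have "(\<integral>\<^sup>+u. \<integral>\<^sup>+g. q (\<phi> g u) \<partial>count_space (carrier G) \<partial>M) \<le> (\<integral>\<^sup>+u. 1 \<partial>M)"
    by (intro nn_integral_mono_AE bound)
  ultimately have "integral\<^sup>N M q * \<infinity> \<le> 1" by (simp add: emeasure_space_1)
  then have "integral\<^sup>N M q = 0"
    by (cases "integral\<^sup>N M q = 0") (auto simp: ennreal_mult_top top_unique)
  then show ?thesis by (simp add: nn_integral_0_iff_AE)
qed

section \<open>Resampling one coordinate of an infinite product\<close>

lemma measurable_PiM_fun_upd [measurable]:
  "(\<lambda>z. (fst z)(k := snd z)) \<in> PiM UNIV M \<Otimes>\<^sub>M M k \<rightarrow>\<^sub>M PiM UNIV M"
  using measurable_add_dim[of k UNIV M] by (simp add: case_prod_beta')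

text \<open>The index \<open>k\<close> already belongs to \<open>UNIV\<close>, so inserting a new
  coordinate overwrites the old one. A generic choice of the other coordinates can thus be
  represented by a point of the full product, without splitting off a factor.\<close>

lemma distr_PiM_fun_upd:
  assumes M: "\<And>i. prob_space (M i)"
  shows "distr (PiM UNIV M \<Otimes>\<^sub>M M k) (PiM UNIV M) (\<lambda>z. (fst z)(k := snd z)) = PiM UNIV M"
proof -
  interpret product_prob_space M UNIV
    using M by (intro product_prob_spaceI)
  interpret pair_sigma_finite "PiM UNIV M" "M k" ..
  have "distr (M k \<Otimes>\<^sub>M PiM UNIV M) (PiM UNIV M) (\<lambda>(u, x). x(k := u)) = PiM UNIV M"
    using distr_pair_PiM_eq_PiM[of UNIV M k] M by simp
  then show ?thesis
    by (subst distr_pair_swap, subst distr_distr) (simp_all add: comp_def case_prod_beta')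
qed

lemma AE_PiM_fun_upd:
  assumes M: "\<And>i. prob_space (M i)" and Q: "AE y in PiM UNIV M. Q y"
  shows "AE x in PiM UNIV M. AE u in M k. Q (x(k := u))"
proof -
  interpret product_prob_space M UNIV
    using M by (intro product_prob_spaceI)
  interpret pair_sigma_finite "PiM UNIV M" "M k" ..
  have "AE z in distr (PiM UNIV M \<Otimes>\<^sub>M M k) (PiM UNIV M) (\<lambda>z. (fst z)(k := snd z)). Q z"
    unfolding distr_PiM_fun_upd[where M = M, OF M] by (fact Q)
  then have "AE z in PiM UNIV M \<Otimes>\<^sub>M M k. Q ((fst z)(k := snd z))"
    by (rule AE_distrD[rotated]) simp
  then show ?thesis using AE_pair by fastforce
qed

lemma AE_PiM_fun_updD:
  assumes M: "\<And>i. prob_space (M i)" and Q[measurable]: "Measurable.pred (PiM UNIV M) Q"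
    and ae: "AE x in PiM UNIV M. AE u in M k. Q (x(k := u))"
  shows "AE y in PiM UNIV M. Q y"
proof -
  interpret product_prob_space M UNIV
    using M by (intro product_prob_spaceI)
  interpret pair_sigma_finite "PiM UNIV M" "M k" ..
  have "AE z in PiM UNIV M \<Otimes>\<^sub>M M k. Q ((fst z)(k := snd z))"
    using ae by (intro AE_pair_measure) simp_all
  then have "AE z in distr (PiM UNIV M \<Otimes>\<^sub>M M k) (PiM UNIV M) (\<lambda>z. (fst z)(k := snd z)). Q z"
    by (subst AE_distr_iff) simp_all
  then show ?thesis unfolding distr_PiM_fun_upd[where M = M, OF M] .
qed

section \<open>Strongly ergodic actions mapped into hyperfinite relations\<close>

text \<open>Strong ergodicity yields an \<open>n\<close> and a set \<open>Z\<close> of large measure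
  that \<rho> maps into a single class of \<open>F n\<close>. That class is finite, so one of its
  points has a preimage of positive measure in \<open>H\<close>.\<close>

lemma strongly_ergodic_hyperfinite_factor_atom:
  fixes M :: "'a measure" and N :: "'n measure"
  assumes act: "pmp_action G M \<phi>" and M: "prob_space M" and G: "countable (carrier G)"
    and se: "strongly_ergodic_action G M \<phi>"
    and N: "standard_borel N" and \<rho>[measurable]: "\<rho> \<in> M \<rightarrow>\<^sub>M N"
    and F: "\<And>n. equiv (space N) (F n)" "\<And>n. F n \<in> sets (N \<Otimes>\<^sub>M N)"
      "\<And>n x. x \<in> space N \<Longrightarrow> finite (F n `` {x})" "\<And>n. F n \<subseteq> F (Suc n)"
    and orb: "AE u in M. \<forall>g\<in>carrier G. \<exists>n. (\<rho> u, \<rho> (\<phi> g u)) \<in> F n"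
    and H[measurable]: "H \<in> sets M" "measure M H > 0"
  obtains p where "p \<in> space N" "measure M {u \<in> H. \<rho> u = p} > 0"
proof -
  interpret prob_space M by fact
  interpret group_action G "space M" \<phi> by (rule pmp_actionD(1)[OF act])
  interpret G: group G using group_hom group_hom.axioms(1) by blast
  note pmp_actionD(2)[OF act, measurable] F(2)[measurable]
  obtain B :: "nat \<Rightarrow> 'n set" where B[measurable]: "\<And>i. B i \<in> sets N"
    and sep: "\<And>P q. finite P \<Longrightarrow> q \<in> space N \<Longrightarrow> q \<notin> P \<Longrightarrow> \<exists>i. q \<in> B i \<and> B i \<inter> P = {}"
    using standard_borel_separating[OF N] by metis
  have monoF: "F m \<subseteq> F n" if "m \<le> n" for m n
    using lift_Suc_mono_le[of F, OF F(4) that] .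
  have \<rho>s: "\<rho> u \<in> space N" if "u \<in> space M" for u
    using measurable_space[OF \<rho> that] .
  have symF: "(b, a) \<in> F n" if "(a, b) \<in> F n" for a b n
    using F(1)[of n] that by (auto simp: equiv_def sym_def)
  have transF: "(a, c) \<in> F n" if "(a, b) \<in> F n" "(b, c) \<in> F n" for a b c n
    using F(1)[of n] that by (auto simp: equiv_def trans_def)
  have reflF: "(a, a) \<in> F n" if "a \<in> space N" for a n
    using F(1)[of n] that by (auto simp: equiv_def refl_on_def)
  \<comment> \<open>\<open>\<A> n\<close> consists of the sets invariant under the subrelation of the orbit relation cut out by
    \<open>F n\<close>, and \<open>C n i\<close> is the saturation of \<open>\<rho> -` B i\<close>. Saturating with the group action in \<open>M\<close>
    rather than with \<open>F n\<close> in \<open>N\<close> keeps measurability elementary.\<close>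
  define \<A> where "\<A> n = {A \<in> sets M. \<forall>u\<in>space M. \<forall>g\<in>carrier G.
      (\<rho> u, \<rho> (\<phi> g u)) \<in> F n \<longrightarrow> (u \<in> A \<longleftrightarrow> \<phi> g u \<in> A)}" for n
  define C where "C n i = {u \<in> space M. \<exists>g\<in>carrier G.
      (\<rho> u, \<rho> (\<phi> g u)) \<in> F n \<and> \<rho> (\<phi> g u) \<in> B i}" for n i
  have \<A>: "sigma_algebra (space M) (\<A> n)" "\<A> n \<subseteq> sets M" for n
  proof -
    show "sigma_algebra (space M) (\<A> n)"
      unfolding sigma_algebra_iff2
    proof (intro conjI ballI allI impI)
      show "\<A> n \<subseteq> Pow (space M)" using sets.sets_into_space by (auto simp: \<A>_def)
      show "{} \<in> \<A> n" by (simp add: \<A>_def)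
      show "space M - A \<in> \<A> n" if "A \<in> \<A> n" for A
        using that element_image by (fastforce simp: \<A>_def)
      show "(\<Union>i. A i) \<in> \<A> n" if "range A \<subseteq> \<A> n" for A :: "nat \<Rightarrow> 'a set"
      proof -
        have "A i \<in> \<A> n" for i using that by blast
        then show ?thesis by (auto simp: \<A>_def)
      qed
    qed
  qed (auto simp: \<A>_def)
  have C\<A>: "C n i \<in> \<A> n" for n i
  proof -
    have "C n i = (\<Union>g\<in>carrier G. {u \<in> space M. (\<rho> u, \<rho> (\<phi> g u)) \<in> F n \<and> \<rho> (\<phi> g u) \<in> B i})"
      by (auto simp: C_def)
    also have "\<dots> \<in> sets M"
    proof (intro sets.countable_UN'' G)
      fix g assume [measurable]: "g \<in> carrier G"
      show "{u \<in> space M. (\<rho> u, \<rho> (\<phi> g u)) \<in> F n \<and> \<rho> (\<phi> g u) \<in> B i} \<in> sets M"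
        by measurable
    qed
    finally have "C n i \<in> sets M" .
    moreover have "u \<in> C n i \<longleftrightarrow> \<phi> g u \<in> C n i"
      if u: "u \<in> space M" and g: "g \<in> carrier G" and gu: "(\<rho> u, \<rho> (\<phi> g u)) \<in> F n" for u g
    proof
      have gus: "\<phi> g u \<in> space M" using element_image u g by blast
      show "\<phi> g u \<in> C n i" if c: "u \<in> C n i"
      proof -
        obtain h where h: "h \<in> carrier G" "(\<rho> u, \<rho> (\<phi> h u)) \<in> F n" "\<rho> (\<phi> h u) \<in> B i"
          using c by (auto simp: C_def)
        have "\<phi> (h \<otimes>\<^bsub>G\<^esub> inv\<^bsub>G\<^esub> g) (\<phi> g u) = \<phi> h u"
          using composition_rule[OF gus, of h "inv\<^bsub>G\<^esub> g"] orbit_sym_aux[OF g u refl] g h(1) by simp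
        then show ?thesis using h g gus transF[OF symF[OF gu] h(2)]
          by (auto simp: C_def intro!: bexI[of _ "h \<otimes>\<^bsub>G\<^esub> inv\<^bsub>G\<^esub> g"])
      qed
      show "u \<in> C n i" if c: "\<phi> g u \<in> C n i"
      proof -
        obtain h where h: "h \<in> carrier G" "(\<rho> (\<phi> g u), \<rho> (\<phi> h (\<phi> g u))) \<in> F n"
          "\<rho> (\<phi> h (\<phi> g u)) \<in> B i"
          using c by (auto simp: C_def)
        have "\<phi> (h \<otimes>\<^bsub>G\<^esub> g) u = \<phi> h (\<phi> g u)"
          using composition_rule[OF u h(1) g] .
        then show ?thesis using h g u transF[OF gu h(2)]
          by (auto simp: C_def intro!: bexI[of _ "h \<otimes>\<^bsub>G\<^esub> g"])
      qed
    qed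
    ultimately show ?thesis by (auto simp: \<A>_def)
  qed
  \<comment> \<open>The images of two points of one orbit are related by some \<open>F m\<close>,
    hence by every later \<open>F n\<close>.\<close>
  have inv: "AE u in M. \<forall>v. (v, u) \<in> orbit_rel G M \<phi> \<longrightarrow>
      (\<forall>\<^sub>F n in sequentially. u \<in> A n \<longleftrightarrow> v \<in> A n)" if A: "\<And>n. A n \<in> \<A> n" for A
    using orb
  proof eventually_elim
    case (elim u)
    show ?case
    proof (intro allI impI)
      fix v assume "(v, u) \<in> orbit_rel G M \<phi>"
      then have "(u, v) \<in> orbit_rel G M \<phi>" by (auto simp: orbit_rel_def)
      then obtain g where g: "u \<in> space M" "g \<in> carrier G" "v = \<phi> g u"
        using orbit_rel_iff[OF group_action_axioms] by blast
      then obtain m where m: "(\<rho> u, \<rho> v) \<in> F m" using elim by blast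
      have "u \<in> A n \<longleftrightarrow> v \<in> A n" if "m \<le> n" for n
        using A[of n] g m monoF[OF that] by (auto simp: \<A>_def)
      then show "\<forall>\<^sub>F n in sequentially. u \<in> A n \<longleftrightarrow> v \<in> A n"
        unfolding eventually_sequentially by blast
    qed
  qed
  have seR: "strongly_ergodic_rel M (orbit_rel G M \<phi>)"
    using se by (simp add: strongly_ergodic_action_def)
  \<comment> \<open>The tolerance is the measure of \<open>H\<close>, so that \<open>Z\<close> must
    meet \<open>H\<close> in positive measure.\<close>
  obtain n Z where Z[measurable]: "Z \<in> sets M" and Zp: "prob Z > 1 - prob H"
    and Zc: "\<And>u v i. u \<in> Z \<Longrightarrow> v \<in> Z \<Longrightarrow> u \<in> C n i \<longleftrightarrow> v \<in> C n i"
    using strongly_ergodic_not_separating[where C = C and \<A> = \<A>, OF M seR \<A> inv C\<A> H(2)]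
    by metis
  have "prob (Z \<union> H) = prob Z + prob H - prob (Z \<inter> H)"
    by (rule measure_Un3) (auto simp: fmeasurable_def less_top[symmetric])
  then have ZH: "prob (Z \<inter> H) > 0" using Zp prob_le_1[of "Z \<union> H"] by linarith
  then have "Z \<inter> H \<noteq> {}" by force
  then obtain u where u: "u \<in> Z" "u \<in> space M" using sets.sets_into_space[OF Z] by blast
  define P where "P = F n `` {\<rho> u}"
  have P: "finite P" "P \<subseteq> space N"
    using F(3)[OF \<rho>s[OF u(2)]] F(1)[of n] by (auto simp: P_def equiv_def refl_on_def)
  \<comment> \<open>If \<open>\<rho> v\<close> were outside the class \<open>P\<close> of
    \<open>\<rho> u\<close>, some \<open>B i\<close> would contain \<open>\<rho> v\<close> and miss
    \<open>P\<close>. Then \<open>v\<close> lies in \<open>C n i\<close> by the unit of the group,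
    while \<open>u\<close> does not, contradicting \<open>Zc\<close>.\<close>
  have ZP: "\<rho> v \<in> P" if v: "v \<in> Z" for v
  proof (rule ccontr)
    assume "\<rho> v \<notin> P"
    have vs: "v \<in> space M" using v sets.sets_into_space[OF Z] by blast
    obtain i where i: "\<rho> v \<in> B i" "B i \<inter> P = {}"
      using sep[OF P(1) \<rho>s[OF vs] \<open>\<rho> v \<notin> P\<close>] by blast
    have "\<phi> \<one>\<^bsub>G\<^esub> v = v" using id_eq_one vs by (metis restrict_apply')
    then have "v \<in> C n i" using vs i(1) reflF[OF \<rho>s[OF vs]]
      by (auto simp: C_def intro!: bexI[of _ "\<one>\<^bsub>G\<^esub>"])
    then have "u \<in> C n i" using Zc[OF u(1) v] by blast
    then show False using i(2) by (auto simp: C_def P_def)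
  qed
  have "\<exists>p\<in>P. prob {v \<in> H. \<rho> v = p} > 0"
  proof (rule ccontr)
    assume "\<not> (\<exists>p\<in>P. prob {v \<in> H. \<rho> v = p} > 0)"
    then have 0: "prob {v \<in> H. \<rho> v = p} = 0" if "p \<in> P" for p
      using that measure_nonneg[of M] by (metis less_eq_real_def)
    have m: "{v \<in> H. \<rho> v = p} \<in> sets M" if "p \<in> P" for p
    proof -
      have [measurable]: "{p} \<in> sets N" using standard_borel_singleton[OF N] P(2) that by blast
      have "{v \<in> H. \<rho> v = p} = H \<inter> {v \<in> space M. \<rho> v \<in> {p}}"
        using sets.sets_into_space[OF H(1)] by auto
      then show ?thesis by simp
    qed
    have "prob (Z \<inter> H) \<le> prob (\<Union>p\<in>P. {v \<in> H. \<rho> v = p})"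
      using ZP m P(1) by (intro finite_measure_mono) auto
    also have "\<dots> \<le> (\<Sum>p\<in>P. prob {v \<in> H. \<rho> v = p})"
      using m P(1) by (intro measure_UNION_le) auto
    also have "\<dots> = 0" using 0 by simp
    finally show False using ZH by simp
  qed
  then show thesis using P(2) that by blast
qed

section \<open>The product action of the direct sum\<close>

lemma product_action_apply:
  "x \<in> space (PiM UNIV M) \<Longrightarrow> product_action M \<phi> g x = (\<lambda>n. \<phi> n (g n) (x n))"
  by (simp add: product_action_def)

lemma group_action_product_action:
  fixes \<Gamma> :: "nat \<Rightarrow> ('g, 'b) monoid_scheme"
  assumes act: "\<And>n. group_action (\<Gamma> n) (space (M n)) (\<phi> n)"
  shows "group_action (sum_group UNIV \<Gamma>) (space (PiM UNIV M)) (product_action M \<phi>)"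
proof -
  let ?G = "sum_group UNIV \<Gamma>" and ?E = "space (PiM UNIV M)" and ?\<Phi> = "product_action M \<phi>"
  have grp: "group (\<Gamma> n)" for n
    using act[of n] by (simp add: group_action_def group_hom_def)
  interpret G: group ?G using grp by simp
  have carr: "g n \<in> carrier (\<Gamma> n)" if "g \<in> carrier ?G" for g n
    using that grp by (auto simp: carrier_sum_group)
  have sp: "x n \<in> space (M n)" if "x \<in> ?E" for x n
    using that by (auto simp: space_PiM PiE_iff)
  have cl: "?\<Phi> g x \<in> ?E" if "g \<in> carrier ?G" "x \<in> ?E" for g x
    using group_action.element_image[OF act carr[OF that(1)] sp[OF that(2)] refl] that(2)
    by (simp add: product_action_apply) (simp add: space_PiM PiE_iff)
  have comp: "?\<Phi> (g \<otimes>\<^bsub>?G\<^esub> h) x = ?\<Phi> g (?\<Phi> h x)"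
    if "g \<in> carrier ?G" "h \<in> carrier ?G" "x \<in> ?E" for g h x
    using that cl[OF that(2,3)]
    by (simp add: product_action_apply group_action.composition_rule[OF act] carr sp)
  have one: "?\<Phi> \<one>\<^bsub>?G\<^esub> x = x" if "x \<in> ?E" for x
  proof -
    have "\<phi> n \<one>\<^bsub>\<Gamma> n\<^esub> (x n) = x n" for n
      using group_action.id_eq_one[OF act, of n] sp[OF that] by (metis restrict_apply')
    then show ?thesis using that by (simp add: product_action_apply)
  qed
  have bij: "?\<Phi> g \<in> Bij ?E" if g: "g \<in> carrier ?G" for g
  proof -
    have i: "inv\<^bsub>?G\<^esub> g \<in> carrier ?G" using g by simp
    have "bij_betw (?\<Phi> g) ?E ?E"
    proof (rule bij_betw_byWitness[where f' = "?\<Phi> (inv\<^bsub>?G\<^esub> g)"])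
      show "\<forall>x\<in>?E. ?\<Phi> (inv\<^bsub>?G\<^esub> g) (?\<Phi> g x) = x"
        using comp[OF i g] one G.l_inv[OF g] by metis
      show "\<forall>x\<in>?E. ?\<Phi> g (?\<Phi> (inv\<^bsub>?G\<^esub> g) x) = x"
        using comp[OF g i] one G.r_inv[OF g] by metis
    qed (use cl[OF g] cl[OF i] in auto)
    then show ?thesis by (simp add: Bij_def product_action_def)
  qed
  have "?\<Phi> \<in> hom ?G (BijGroup ?E)"
  proof (rule homI)
    show "?\<Phi> g \<in> carrier (BijGroup ?E)" if "g \<in> carrier ?G" for g
      using bij[OF that] by (simp add: BijGroup_def)
    show "?\<Phi> (g \<otimes>\<^bsub>?G\<^esub> h) = ?\<Phi> g \<otimes>\<^bsub>BijGroup ?E\<^esub> ?\<Phi> h"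
      if "g \<in> carrier ?G" "h \<in> carrier ?G" for g h
    proof -
      have "?\<Phi> (g \<otimes>\<^bsub>?G\<^esub> h) = compose ?E (?\<Phi> g) (?\<Phi> h)"
      proof (rule extensionalityI[of _ ?E])
        show "?\<Phi> (g \<otimes>\<^bsub>?G\<^esub> h) \<in> extensional ?E"
          unfolding product_action_def by (rule restrict_extensional)
        show "compose ?E (?\<Phi> g) (?\<Phi> h) \<in> extensional ?E" by (rule compose_extensional)
      qed (use comp[OF that] in \<open>simp add: compose_eq\<close>)
      then show ?thesis using bij that by (simp add: BijGroup_def)
    qed
  qed
  then show ?thesis
    by (simp add: group_action_def group_hom_def group_hom_axioms_def group_BijGroup
        G.group_axioms)
qed

text \<open>Elements of \<open>sum_group\<close> have finite support.\<close>

lemma orbit_rel_product_action_eventually_eq: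
  fixes \<Gamma> :: "nat \<Rightarrow> ('g, 'b) monoid_scheme"
  assumes act: "\<And>n. group_action (\<Gamma> n) (space (M n)) (\<phi> n)"
    and xy: "(x, y) \<in> orbit_rel (sum_group UNIV \<Gamma>) (PiM UNIV M) (product_action M \<phi>)"
  shows "\<forall>\<^sub>F n in sequentially. x n = y n"
proof -
  have grp: "group (\<Gamma> n)" for n
    using act[of n] by (simp add: group_action_def group_hom_def)
  obtain g where x: "x \<in> space (PiM UNIV M)" and g: "g \<in> carrier (sum_group UNIV \<Gamma>)"
    and y: "y = product_action M \<phi> g x"
    using xy orbit_rel_iff[OF group_action_product_action[where \<Gamma> = \<Gamma> and M = M and \<phi> = \<phi>, OF act]] by blast
  have "finite {n. g n \<noteq> \<one>\<^bsub>\<Gamma> n\<^esub>}" using g grp by (auto simp: carrier_sum_group)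
  then have "\<forall>\<^sub>F n in sequentially. g n = \<one>\<^bsub>\<Gamma> n\<^esub>"
    by (simp add: cofinite_eq_sequentially[symmetric] eventually_cofinite)
  then show ?thesis
  proof eventually_elim
    case (elim n)
    have "x n \<in> space (M n)" using x by (auto simp: space_PiM PiE_iff)
    then have "\<phi> n (g n) (x n) = x n"
      using group_action.id_eq_one[OF act, of n] elim by (metis restrict_apply')
    then show ?case using x y by (simp add: product_action_apply)
  qed
qed

text \<open>The witness is the image of \<open>g\<close> in the direct sum: \<open>g\<close> at
  \<open>k\<close> and the unit elsewhere.\<close>

lemma fun_upd_in_orbit_rel_product_action:
  fixes \<Gamma> :: "nat \<Rightarrow> ('g, 'b) monoid_scheme"
  assumes act: "\<And>n. group_action (\<Gamma> n) (space (M n)) (\<phi> n)"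
    and x: "x \<in> space (PiM UNIV M)" and u: "u \<in> space (M k)" and g: "g \<in> carrier (\<Gamma> k)"
  shows "(x(k := u), x(k := \<phi> k g u)) \<in>
    orbit_rel (sum_group UNIV \<Gamma>) (PiM UNIV M) (product_action M \<phi>)"
proof -
  have grp: "group (\<Gamma> n)" for n
    using act[of n] by (simp add: group_action_def group_hom_def)
  define h where "h = (\<lambda>n. \<one>\<^bsub>\<Gamma> n\<^esub>)(k := g)"
  have "{n. h n \<noteq> \<one>\<^bsub>\<Gamma> n\<^esub>} \<subseteq> {k}" by (auto simp: h_def)
  then have "finite {n. h n \<noteq> \<one>\<^bsub>\<Gamma> n\<^esub>}" by (rule finite_subset) simp
  then have h: "h \<in> carrier (sum_group UNIV \<Gamma>)"
    using g grp by (auto simp: carrier_sum_group h_def group.is_monoid)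
  have xu: "x(k := u) \<in> space (PiM UNIV M)"
    using x u by (auto simp: space_PiM PiE_iff)
  have one: "\<phi> n \<one>\<^bsub>\<Gamma> n\<^esub> (x n) = x n" for n
  proof -
    have "x n \<in> space (M n)" using x by (auto simp: space_PiM PiE_iff)
    then show ?thesis
      using group_action.id_eq_one[OF act, of n] by (metis restrict_apply')
  qed
  have "product_action M \<phi> h (x(k := u)) = x(k := \<phi> k g u)"
    using one by (auto simp: product_action_apply[OF xu] h_def)
  then show ?thesis
    using orbit_rel_iff[OF group_action_product_action[where \<Gamma> = \<Gamma> and M = M and \<phi> = \<phi>, OF act]] xu h by metis
qed

section \<open>Masses of coordinate fibres in the ergodic components\<close>

text \<open>Both the measure and the fibre vary with \<open>y\<close>, so the fibres must form a
  jointly measurable set; it is the preimage of the diagonal of \<open>M k\<close>.\<close>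

lemma measurable_coordinate_fibre_measure:
  assumes M: "\<And>n. standard_borel (M n)"
    and e: "e \<in> PiM UNIV M \<rightarrow>\<^sub>M prob_algebra (PiM UNIV M)"
  shows "(\<lambda>y. emeasure (e y) {z \<in> space (PiM UNIV M). z k = y k}) \<in>
    borel_measurable (PiM UNIV M)"
proof (rule emeasure_measurable_subprob_algebra2)
  show "e \<in> PiM UNIV M \<rightarrow>\<^sub>M subprob_algebra (PiM UNIV M)"
    using e by (rule measurable_prob_algebraD)
  let ?X = "PiM UNIV M"
  note [measurable] = standard_borel_diagonal[OF M, of k]
  have f: "(\<lambda>w. (fst w k, snd w k)) \<in> ?X \<Otimes>\<^sub>M ?X \<rightarrow>\<^sub>M M k \<Otimes>\<^sub>M M k"
    by measurable
  have "(SIGMA y:space ?X. {z \<in> space ?X. z k = y k}) =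
      (\<lambda>w. (fst w k, snd w k)) -` {z \<in> space (M k \<Otimes>\<^sub>M M k). fst z = snd z} \<inter> space (?X \<Otimes>\<^sub>M ?X)"
    by (auto simp: space_pair_measure space_PiM)
  also have "\<dots> \<in> sets (?X \<Otimes>\<^sub>M ?X)"
    by (rule measurable_sets[OF f]) measurable
  finally show "(SIGMA y:space ?X. {z \<in> space ?X. z k = y k}) \<in> sets (?X \<Otimes>\<^sub>M ?X)" .
qed

text \<open>Here \<open>m\<close> stands for an ergodic component. Sets in the \<open>n\<close>-th
  coordinate are asymptotically invariant, so for some \<open>k\<close> the coordinate
  \<open>k\<close> is constant on a set \<open>Z\<close> with mass above 1/2; every point of
  \<open>Z\<close> then has a fibre of positive mass.\<close>

lemma strongly_ergodic_product_coordinate_atom: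
  fixes M :: "nat \<Rightarrow> 'x measure"
  assumes M: "\<And>n. standard_borel (M n)"
    and m: "prob_space m" "sets m = sets (PiM UNIV M)" and se: "strongly_ergodic_rel m R"
    and R: "R \<subseteq> space m \<times> space m"
      "\<And>x y. (x, y) \<in> R \<Longrightarrow> \<forall>\<^sub>F n in sequentially. x n = y n"
  obtains k where "\<not> (AE y in m. emeasure m {z \<in> space (PiM UNIV M). z k = y k} = 0)"
proof -
  let ?X = "PiM UNIV M"
  interpret prob_space m by fact
  have sp: "space m = space ?X" using m(2) by (rule sets_eq_imp_space_eq)
  have "\<forall>n. \<exists>B :: nat \<Rightarrow> 'x set. (\<forall>i. B i \<in> sets (M n)) \<and>
      (\<forall>P q. finite P \<longrightarrow> q \<in> space (M n) \<longrightarrow> q \<notin> P \<longrightarrow> (\<exists>i. q \<in> B i \<and> B i \<inter> P = {}))"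
    using standard_borel_separating[OF M] by metis
  from choice[OF this] obtain B :: "nat \<Rightarrow> nat \<Rightarrow> 'x set"
    where Bsep: "\<forall>n. (\<forall>i. B n i \<in> sets (M n)) \<and>
      (\<forall>P q. finite P \<longrightarrow> q \<in> space (M n) \<longrightarrow> q \<notin> P \<longrightarrow> (\<exists>i. q \<in> B n i \<and> B n i \<inter> P = {}))" ..
  have B: "B n i \<in> sets (M n)" for n i using Bsep by simp
  have sep: "\<exists>i. q \<in> B n i \<and> B n i \<inter> P = {}"
    if "finite P" "q \<in> space (M n)" "q \<notin> P" for n P q
    using Bsep[rule_format, of n] that by simp
  have coord: "(\<lambda>y. y n) \<in> space m \<rightarrow> space (M n)" for n
    by (auto simp: sp space_PiM)
  define \<A> where "\<A> n = {(\<lambda>y. y n) -` A \<inter> space m | A. A \<in> sets (M n)}" for n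
  have \<A>eq: "\<A> n = sets (vimage_algebra (space m) (\<lambda>y. y n) (M n))" for n
    using coord by (simp add: \<A>_def sets_vimage_algebra2)
  have \<A>1: "sigma_algebra (space m) (\<A> n)" for n
    unfolding \<A>eq by (metis sets.sigma_algebra_axioms space_vimage_algebra)
  have \<A>2: "\<A> n \<subseteq> sets m" for n
    by (auto simp: \<A>_def sp m(2) intro!: measurable_sets[of _ ?X])
  define C where "C n i = (\<lambda>y. y n) -` B n i \<inter> space m" for n i
  have C: "C n i \<in> \<A> n" for n i using B by (auto simp: \<A>_def C_def)
  have inv: "AE x in m. \<forall>y. (y, x) \<in> R \<longrightarrow> (\<forall>\<^sub>F n in sequentially. x \<in> A n \<longleftrightarrow> y \<in> A n)"
    if A: "\<And>n. A n \<in> \<A> n" for A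
  proof (intro AE_I2 allI impI)
    fix x y assume xy: "(y, x) \<in> R"
    obtain A' where A': "\<And>n. A n = (\<lambda>y. y n) -` A' n \<inter> space m"
      using A unfolding \<A>_def by simp metis
    have xys: "x \<in> space m" "y \<in> space m" using xy R(1) by auto
    show "\<forall>\<^sub>F n in sequentially. x \<in> A n \<longleftrightarrow> y \<in> A n"
      using R(2)[OF xy] by eventually_elim (use A' xys in auto)
  qed
  obtain k Z where Z: "Z \<in> sets m" "prob Z > 1 - 1 / 2"
    and Zc: "\<And>u v i. u \<in> Z \<Longrightarrow> v \<in> Z \<Longrightarrow> u \<in> C k i \<longleftrightarrow> v \<in> C k i"
    using strongly_ergodic_not_separating[where C = C and \<A> = \<A> and \<epsilon> = "1 / 2",
        OF m(1) se \<A>1 \<A>2 inv C] by (metis half_gt_zero zero_less_one)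
  have Zs: "u \<in> space m" if "u \<in> Z" for u using that sets.sets_into_space[OF Z(1)] by blast
  have const: "u k = v k" if uv: "u \<in> Z" "v \<in> Z" for u v
  proof (rule ccontr)
    assume "u k \<noteq> v k"
    then obtain i where "u k \<in> B k i" "B k i \<inter> {v k} = {}"
      using sep[of "{v k}" "u k" k] coord[of k] Zs[OF uv(1)] by auto
    then show False using Zc[OF uv, of i] Zs uv by (auto simp: C_def)
  qed
  show thesis
  proof (rule that[of k], rule notI)
    assume "AE y in m. emeasure m {z \<in> space ?X. z k = y k} = 0"
    then have "AE y in m. y \<notin> Z"
    proof eventually_elim
      case (elim y)
      show ?case
      proof
        assume y: "y \<in> Z"
        have "{z \<in> space ?X. z k = y k} \<in> sets m"
        proof (rule ccontr)
          assume "{z \<in> space ?X. z k = y k} \<notin> sets m"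
          moreover have "{z \<in> space ?X. z k = y k} = (\<lambda>z. z k) -` {y k} \<inter> space ?X" by auto
          moreover have "{y k} \<in> sets (M k)"
            using standard_borel_singleton[OF M] coord Zs[OF y] by blast
          ultimately show False using m(2) measurable_sets[of "\<lambda>z. z k" ?X "M k"] by auto
        qed
        then have "emeasure m Z \<le> emeasure m {z \<in> space ?X. z k = y k}"
          using const[OF _ y] Zs sp by (intro emeasure_mono) auto
        then show False using elim Z(2) by (simp add: emeasure_eq_measure)
      qed
    qed
    then have "prob Z = 0" using prob_eq_0[OF Z(1)] by simp
    then show False using Z(2) by simp
  qed
qed

text \<open>If the fibre masses vanished almost everywhere for every \<open>k\<close>, then, as
  \<open>bind\<close> recovers the product measure, they would vanish almost everywhere in almost
  every component. There \<open>e y\<close> may be replaced by the constant \<open>e x\<close>,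
  contradicting the previous lemma.\<close>

lemma ergodic_decomposition_coordinate_atom:
  fixes M :: "nat \<Rightarrow> 'x measure"
  assumes M: "\<And>n. standard_prob_space (M n)"
    and e: "ergodic_decomposition (PiM UNIV M) R e"
    and se: "AE x in PiM UNIV M. strongly_ergodic_rel (e x) R"
    and R: "R \<subseteq> space (PiM UNIV M) \<times> space (PiM UNIV M)"
      "\<And>x y. (x, y) \<in> R \<Longrightarrow> \<forall>\<^sub>F n in sequentially. x n = y n"
  obtains k where
    "\<not> (AE y in PiM UNIV M. emeasure (e y) {z \<in> space (PiM UNIV M). z k = y k} = 0)"
proof -
  let ?X = "PiM UNIV M"
  let ?f = "\<lambda>k y. emeasure (e y) {z \<in> space ?X. z k = y k}"
  have Mp: "prob_space (M n)" and Mb: "standard_borel (M n)" for n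
    using M[of n] by (auto simp: standard_prob_space_def)
  interpret X: prob_space ?X using Mp by (rule prob_space_PiM)
  have em: "e \<in> ?X \<rightarrow>\<^sub>M prob_algebra ?X" and bind: "bind ?X e = ?X"
    and ee: "AE x in ?X. AE y in e x. e y = e x"
    using e by (auto simp: ergodic_decomposition_def)
  note fm[measurable] = measurable_coordinate_fibre_measure[OF Mb em]
  show thesis
  proof (rule ccontr)
    assume "\<not> thesis"
    then have "AE y in ?X. ?f k y = 0" for k using that by blast
    then have "AE y in bind ?X e. \<forall>k. ?f k y = 0"
      unfolding bind by (simp add: AE_all_countable)
    then have "AE x in ?X. AE y in e x. \<forall>k. ?f k y = 0"
      using AE_bind[OF measurable_prob_algebraD[OF em], of "\<lambda>y. \<forall>k. ?f k y = 0"] by simp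
    then have "AE x in ?X. False"
      using ee se AE_space
    proof eventually_elim
      case (elim x)
      have m: "prob_space (e x)" "sets (e x) = sets ?X"
        using measurable_space[OF em elim(4)] by (auto simp: space_prob_algebra)
      have "R \<subseteq> space (e x) \<times> space (e x)"
        using R(1) sets_eq_imp_space_eq[OF m(2)] by simp
      then obtain k where k: "\<not> (AE y in e x. emeasure (e x) {z \<in> space ?X. z k = y k} = 0)"
        using strongly_ergodic_product_coordinate_atom[OF Mb m elim(3) _ R(2)] by blast
      moreover have "AE y in e x. emeasure (e x) {z \<in> space ?X. z k = y k} = 0"
        using elim(1,2) by eventually_elim metis
      ultimately show False by blast
    qed
    then show False by simp
  qed
qed

section \<open>Freeness, and the contradiction on a single factor\<close>

lemma free_action_AE_inj_on:
  assumes act: "pmp_action G M \<phi>" and G: "countable (carrier G)"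
    and free: "free_action G M \<phi>"
  shows "AE u in M. inj_on (\<lambda>g. \<phi> g u) (carrier G)"
proof -
  interpret group_action G "space M" \<phi> by (rule pmp_actionD(1)[OF act])
  interpret G: group G using group_hom group_hom.axioms(1) by blast
  have "AE u in M. \<forall>g\<in>carrier G - {\<one>\<^bsub>G\<^esub>}. \<phi> g u \<noteq> u"
    using free G by (subst AE_ball_countable) (auto simp: free_action_def)
  then show ?thesis
    using AE_space
  proof eventually_elim
    case (elim u)
    show ?case
    proof (rule inj_onI)
      fix g h assume gh: "g \<in> carrier G" "h \<in> carrier G" "\<phi> g u = \<phi> h u"
      have "\<phi> (inv\<^bsub>G\<^esub> h \<otimes>\<^bsub>G\<^esub> g) u = \<phi> (inv\<^bsub>G\<^esub> h) (\<phi> h u)"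
        using composition_rule[OF elim(2), of "inv\<^bsub>G\<^esub> h" g] gh by simp
      also have "\<dots> = u" using orbit_sym_aux[OF gh(2) elim(2) refl] by simp
      finally have "inv\<^bsub>G\<^esub> h \<otimes>\<^bsub>G\<^esub> g = \<one>\<^bsub>G\<^esub>" using elim(1) gh by auto
      then have "h = g" using gh by (metis G.inv_equality G.inv_inv G.inv_closed)
      then show "g = h" by simp
    qed
  qed
qed

theorem theorem5:
  fixes \<Gamma> :: "nat \<Rightarrow> ('g, 'b) monoid_scheme"
    and M :: "nat \<Rightarrow> 'x measure"
    and \<phi> :: "nat \<Rightarrow> 'g \<Rightarrow> 'x \<Rightarrow> 'x"
  assumes "\<And>n. countable (carrier (\<Gamma> n))"
    and "\<And>n. infinite (carrier (\<Gamma> n))"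
    and "\<And>n. standard_prob_space (M n)"
    and "\<And>n. pmp_action (\<Gamma> n) (M n) (\<phi> n)"
    and "\<And>n. free_action (\<Gamma> n) (M n) (\<phi> n)"
    and "\<And>n. strongly_ergodic_action (\<Gamma> n) (M n) (\<phi> n)"
  shows "\<not> jones_schmidt TYPE('y) (PiM UNIV M)
           (orbit_rel (sum_group UNIV \<Gamma>) (PiM UNIV M) (product_action M \<phi>))"
proof
  let ?X = "PiM UNIV M"
  let ?S = "orbit_rel (sum_group UNIV \<Gamma>) ?X (product_action M \<phi>)"
  assume "jones_schmidt TYPE('y) ?X ?S"
  then obtain N :: "'y measure" and T \<pi> e where N: "standard_prob_space N" and hf: "hyperfinite_rel N T"
    and \<pi>: "measure_preserving_map ?X N \<pi>"
    and \<pi>S: "AE x in ?X. \<pi> ` (?S `` {x}) = T `` {\<pi> x}"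
    and e: "ergodic_decomposition ?X (kernel_subrel ?S \<pi>) e"
    and se: "AE x in ?X. strongly_ergodic_rel (e x) (kernel_subrel ?S \<pi>)"
    unfolding jones_schmidt_def by auto
  define R where "R = kernel_subrel ?S \<pi>"
  have Mp: "prob_space (M n)" and Mb: "standard_borel (M n)" for n
    using assms(3)[of n] by (auto simp: standard_prob_space_def)
  have act: "group_action (\<Gamma> n) (space (M n)) (\<phi> n)" for n
    using pmp_actionD(1)[OF assms(4)] .
  have Nb: "standard_borel N" using N by (simp add: standard_prob_space_def)
  have \<pi>m[measurable]: "\<pi> \<in> ?X \<rightarrow>\<^sub>M N" and \<pi>d: "distr ?X N \<pi> = N"
    using \<pi> by (auto simp: measure_preserving_map_def)
  have em: "e \<in> ?X \<rightarrow>\<^sub>M prob_algebra ?X" and eR: "AE x in ?X. \<forall>y\<in>R `` {x}. e y = e x"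
    using e by (auto simp: ergodic_decomposition_def R_def)
  obtain F where F0: "\<forall>n. equiv (space N) (F n) \<and> F n \<in> sets (N \<Otimes>\<^sub>M N) \<and>
      (\<forall>x\<in>space N. finite (F n `` {x})) \<and> F n \<subseteq> F (Suc n)"
    and TF: "AE x in N. T `` {x} = (\<Union>n. F n `` {x})"
    using hf unfolding hyperfinite_rel_def by (elim exE conjE)
  have F: "equiv (space N) (F n)" "F n \<in> sets (N \<Otimes>\<^sub>M N)"
    "x \<in> space N \<Longrightarrow> finite (F n `` {x})" "F n \<subseteq> F (Suc n)" for n x
    using F0 by simp_all
  have TF\<pi>: "AE x in ?X. T `` {\<pi> x} = (\<Union>n. F n `` {\<pi> x})"
    by (rule AE_distrD[OF \<pi>m]) (subst \<pi>d, rule TF)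
  obtain k where k: "\<not> (AE y in ?X. emeasure (e y) {z \<in> space ?X. z k = y k} = 0)"
  proof (rule ergodic_decomposition_coordinate_atom[OF assms(3) e se])
    show "kernel_subrel ?S \<pi> \<subseteq> space ?X \<times> space ?X"
      by (auto simp: kernel_subrel_def orbit_rel_def)
    show "\<forall>\<^sub>F n in sequentially. x n = y n" if "(x, y) \<in> kernel_subrel ?S \<pi>" for x y
      using orbit_rel_product_action_eventually_eq[where \<Gamma> = \<Gamma> and M = M and \<phi> = \<phi>, OF act] that
      by (simp add: kernel_subrel_def)
  qed
  let ?G = "\<Gamma> k" and ?M = "M k" and ?\<phi> = "\<phi> k"
  interpret Mk: prob_space ?M by (rule Mp)
  interpret group_action ?G "space ?M" ?\<phi> by (rule act)
  define f where "f y = emeasure (e y) {z \<in> space ?X. z k = y k}" for y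
  have f[measurable]: "f \<in> borel_measurable ?X"
    unfolding f_def by (rule measurable_coordinate_fibre_measure[OF Mb em])
  \<comment> \<open>The conull conditions are bundled, with classes of \<open>T\<close> already
    replaced by unions of classes of \<open>F n\<close>, so that they can be restricted to a slice
    and translated by the group together.\<close>
  define good where "good y \<longleftrightarrow> \<pi> ` (?S `` {y}) = (\<Union>n. F n `` {\<pi> y}) \<and> (\<forall>z\<in>R `` {y}. e z = e y)"
    for y
  have "AE y in ?X. good y"
    using \<pi>S TF\<pi> eR by eventually_elim (auto simp: good_def)
  then have gx: "AE x in ?X. AE u in ?M. good (x(k := u))"
    by (rule AE_PiM_fun_upd[where M = M, OF Mp])
  have "\<not> (AE x in ?X. AE u in ?M. f (x(k := u)) = 0)"
    using AE_PiM_fun_updD[where M = M and Q = "\<lambda>y. f y = 0" and k = k, OF Mp] k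
    by (auto simp: f_def[symmetric])
  \<comment> \<open>From here on \<open>x\<close> is fixed, and the argument takes place on the
    slice of points \<open>x(k := u)\<close>. The choice is possible because the first condition
    holds for almost every \<open>x\<close> and the second fails to be null.\<close>
  then obtain x where x: "x \<in> space ?X" and good: "AE u in ?M. good (x(k := u))"
    and fx: "\<not> (AE u in ?M. f (x(k := u)) = 0)"
    using gx AE_space[of ?X] by (smt (verit, ccfv_threshold) eventually_elim2)
  have updm[measurable]: "(\<lambda>u. x(k := u)) \<in> ?M \<rightarrow>\<^sub>M ?X"
    using measurable_compose[OF measurable_Pair1'[OF x] measurable_PiM_fun_upd] by simp
  define \<rho> where "\<rho> u = \<pi> (x(k := u))" for u
  have \<rho>[measurable]: "\<rho> \<in> ?M \<rightarrow>\<^sub>M N" unfolding \<rho>_def by measurable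
  have Sg: "(x(k := u), x(k := ?\<phi> g u)) \<in> ?S" if "u \<in> space ?M" "g \<in> carrier ?G" for u g
    by (rule fun_upd_in_orbit_rel_product_action[where \<Gamma> = \<Gamma> and M = M and \<phi> = \<phi>, OF act x that])
  have orb: "AE u in ?M. \<forall>g\<in>carrier ?G. \<exists>n. (\<rho> u, \<rho> (?\<phi> g u)) \<in> F n"
    using good AE_space
  proof eventually_elim
    case (elim u)
    show ?case
    proof
      fix g assume "g \<in> carrier ?G"
      then have "\<rho> (?\<phi> g u) \<in> \<pi> ` (?S `` {x(k := u)})"
        using Sg[OF elim(2)] by (auto simp: \<rho>_def)
      also have "\<dots> = (\<Union>n. F n `` {\<rho> u})" using elim(1) by (simp add: good_def \<rho>_def)
      finally show "\<exists>n. (\<rho> u, \<rho> (?\<phi> g u)) \<in> F n" by auto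
    qed
  qed
  define H where "H = {u \<in> space ?M. f (x(k := u)) \<noteq> 0}"
  have H: "H \<in> sets ?M" unfolding H_def by measurable
  have "Mk.prob H \<noteq> 0" using Mk.prob_eq_0[OF H] fx by (auto simp: H_def elim: eventually_mono)
  then have Hp: "Mk.prob H > 0" by (simp add: zero_less_measure_iff)
  obtain p where p: "p \<in> space N" and pH: "Mk.prob {u \<in> H. \<rho> u = p} > 0"
    by (rule strongly_ergodic_hyperfinite_factor_atom[OF assms(4) Mp assms(1) assms(6) Nb \<rho> F orb H Hp])
  have [measurable]: "{p} \<in> sets N" by (rule standard_borel_singleton[OF Nb p])
  \<comment> \<open>The points of an orbit on which \<open>\<rho>\<close> has the value \<open>p\<close> are equivalent under \<open>R\<close>, so they share
    one measure \<open>e\<close>, of which the values of \<open>f\<close> are the masses of distinct fibres of the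
    coordinate \<open>k\<close>. Thus \<open>q\<close> has sum at most 1 along orbits.\<close>
  define q where "q u = indicator {p} (\<rho> u) * f (x(k := u))" for u
  have q[measurable]: "q \<in> borel_measurable ?M" unfolding q_def by measurable
  \<comment> \<open>The base point \<open>g0\<close> chosen below depends on \<open>u\<close>, so
    goodness is needed along the whole orbit.\<close>
  have "AE u in ?M. \<forall>g\<in>carrier ?G. good (x(k := ?\<phi> g u))"
  proof (subst AE_ball_countable[OF assms(1)], rule ballI)
    fix g assume g: "g \<in> carrier ?G"
    show "AE u in ?M. good (x(k := ?\<phi> g u))"
      by (rule AE_distrD[OF pmp_actionD(2)[OF assms(4) g]])
        (subst pmp_actionD(3)[OF assms(4) g], rule good)
  qed
  moreover have "AE u in ?M. inj_on (\<lambda>g. ?\<phi> g u) (carrier ?G)"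
    by (rule free_action_AE_inj_on[OF assms(4) assms(1) assms(5)])
  ultimately have "AE u in ?M. (\<integral>\<^sup>+g. q (?\<phi> g u) \<partial>count_space (carrier ?G)) \<le> 1"
    using AE_space
  proof eventually_elim
    case (elim u)
    define I where "I = {g \<in> carrier ?G. \<rho> (?\<phi> g u) = p}"
    show ?case
    proof (cases "I = {}")
      case True
      then have "q (?\<phi> g u) = 0" if "g \<in> carrier ?G" for g
        using that by (auto simp: q_def I_def)
      then have "(\<integral>\<^sup>+g. q (?\<phi> g u) \<partial>count_space (carrier ?G)) = (\<integral>\<^sup>+g. 0 \<partial>count_space (carrier ?G))"
        by (intro nn_integral_cong) simp
      then show ?thesis by simp
    next
      case False
      then obtain g0 where g0: "g0 \<in> carrier ?G" "\<rho> (?\<phi> g0 u) = p" by (auto simp: I_def)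
      define m where "m = e (x(k := ?\<phi> g0 u))"
      have gs: "?\<phi> g u \<in> space ?M" if "g \<in> carrier ?G" for g
        using element_image[OF that elim(3) refl] .
      have "x(k := ?\<phi> g0 u) \<in> space ?X" using measurable_space[OF updm gs[OF g0(1)]] .
      then have m: "prob_space m" "sets m = sets ?X"
        using measurable_space[OF em] by (auto simp: m_def space_prob_algebra)
      interpret m: prob_space m by fact
      \<comment> \<open>The value \<open>{}\<close> off \<open>I\<close> matches the indicator in
        \<open>q\<close>, so the sum can run over the whole group.\<close>
      define D where "D g = (if g \<in> I then {z \<in> space ?X. z k = ?\<phi> g u} else {})" for g
      have D: "D g \<in> sets m" if "g \<in> carrier ?G" for g
      proof -
        have [measurable]: "{?\<phi> g u} \<in> sets ?M" by (rule standard_borel_singleton[OF Mb gs[OF that]])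
        have "{z \<in> space ?X. z k \<in> {?\<phi> g u}} \<in> sets ?X" by measurable
        then show ?thesis using m(2) by (simp add: D_def)
      qed
      have "q (?\<phi> g u) = emeasure m (D g)" if g: "g \<in> carrier ?G" for g
      proof (cases "g \<in> I")
        case True
        have S: "(x(k := ?\<phi> g0 u), x(k := ?\<phi> g u)) \<in> ?S"
          using Sg[OF elim(3) g0(1)] Sg[OF elim(3) g] by (auto simp: orbit_rel_def)
        then have "(x(k := ?\<phi> g0 u), x(k := ?\<phi> g u)) \<in> R"
          using True g0(2) by (auto simp: R_def kernel_subrel_def I_def \<rho>_def)
        then have "e (x(k := ?\<phi> g u)) = m"
          using elim(1) g0(1) by (auto simp: m_def good_def)
        then show ?thesis using True by (simp add: q_def D_def I_def f_def)
      qed (use g in \<open>auto simp: q_def D_def I_def\<close>)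
      then have "(\<integral>\<^sup>+g. q (?\<phi> g u) \<partial>count_space (carrier ?G)) =
          (\<integral>\<^sup>+g. emeasure m (D g) \<partial>count_space (carrier ?G))"
        by (intro nn_integral_cong) simp
      also have "\<dots> = emeasure m (\<Union>g\<in>carrier ?G. D g)"
      proof (rule emeasure_UN_countable[symmetric])
        \<comment> \<open>Freeness enters here: distinct \<open>g\<close> give distinct points
          \<open>\<phi> k g u\<close>, hence disjoint fibres.\<close>
        show "disjoint_family_on D (carrier ?G)"
          using elim(2) by (auto simp: disjoint_family_on_def D_def inj_on_def)
      qed (use D assms(1) in auto)
      also have "\<dots> \<le> 1" by (rule m.emeasure_le_1)
      finally show ?thesis .
    qed
  qed
  then have "AE u in ?M. q u = 0"
    by (rule pmp_action_AE_eq_0[OF assms(4) Mp assms(1) assms(2) q])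
  \<comment> \<open>On this set both factors of \<open>q\<close> are nonzero, so it is null, against
    the choice of \<open>p\<close>.\<close>
  then have "AE u in ?M. u \<notin> {u \<in> H. \<rho> u = p}"
    by eventually_elim (auto simp: q_def H_def)
  moreover have "{u \<in> H. \<rho> u = p} \<in> sets ?M"
  proof -
    have "{u \<in> H. \<rho> u = p} = H \<inter> {u \<in> space ?M. \<rho> u \<in> {p}}" by (auto simp: H_def)
    then show ?thesis using H by simp
  qed
  ultimately have "Mk.prob {u \<in> H. \<rho> u = p} = 0" using Mk.prob_eq_0 by blast
  then show False using pH by simp
qed

end
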